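(* Let $\mathcal P$ be a closed, convex and CP admissible set in $\mathbb R^N$. Then $\mathrm{cone}(\mathcal P)=\{\lambda x : \lambda\ge0,\ x\in\mathcal P\}$, and $\mathrm{cone}(\mathcal P)$ is a closed, convex and CP admissible cone.
   Context: For $x\in\mathbb R^N$, $\mathrm{supp}(x)=\{i: x_i\ne0\}$. For an index set $\mathcal I\subseteq\{1,\dots,N\}$, $\pi_{\mathcal I}:\mathbb R^N\to\mathbb R^N$ keeps the coordinates in $\mathcal I$ and sets all others to $0$. A nonempty set $\mathcal P\subseteq\mathbb R^N$ is coordinate projection admissible (CP admissible) if for any $x\in\mathcal P$ and any index set $\mathcal J\subseteq\mathrm{supp}(x)$ (possibly empty), $\pi_{\mathcal J}(x)\in\mathcal P$. $\mathrm{cone}(\mathcal U)$ denotes the conic hull of a nonempty set $\mathcal U$: the collection of all nonnegative combinations of finitely many vectors in $\mathcal U$. *)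

theory Defs
  imports "HOL-Analysis.Analysis"
begin

definition supp :: "real ^ 'n \<Rightarrow> 'n set" where
  "supp x = {i. x $ i \<noteq> 0}"

definition coord_proj :: "'n set \<Rightarrow> real ^ 'n \<Rightarrow> real ^ 'n" where
  "coord_proj I x = (\<chi> i. if i \<in> I then x $ i else 0)"

definition CP_admissible :: "(real ^ 'n) set \<Rightarrow> bool" where
  "CP_admissible P \<longleftrightarrow>
     P \<noteq> {} \<and> (\<forall>x\<in>P. \<forall>J. J \<subseteq> supp x \<longrightarrow> coord_proj J x \<in> P)"

(* Not the library's "cone hull" or "conic hull": those close only under
   nonnegative scaling, not under sums.  Used for nonempty U, where admitting
   the empty combination (value 0) makes no difference. *)
definition conical_hull :: "'a::real_vector set \<Rightarrow> 'a set" where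
  "conical_hull U =
     {y. \<exists>S c. finite S \<and> S \<subseteq> U \<and> (\<forall>u\<in>S. 0 \<le> c u) \<and> y = (\<Sum>u\<in>S. c u *\<^sub>R u)}"

end

theory Submission
  imports Defs
begin

text \<open>A convex cone that is CP admissible contains, along with a vector \<open>z\<close>, the ray spanned by
each \<open>z\<^sub>i e\<^sub>i\<close>, hence every vector whose nonzero coordinates have the signs of those
of \<open>z\<close>. A point in the closure shares its signs, on its support, with some element of the
cone, so the cone is closed.\<close>

text \<open>Convexity makes the set of nonnegative multiples of points of \<open>P\<close> closed
  under sums, so a finite combination collapses to a single multiple. Nonemptiness puts 0, the value
  of the empty combination, into \<open>cone hull P\<close>.\<close>

lemma conical_hull_convex:
  fixes P :: "'a::real_vector set"
  assumes "convex P" and "P \<noteq> {}"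
  shows "conical_hull P = cone hull P"
proof
  have cc: "convex (cone hull P) \<and> cone (cone hull P)"
    using assms(1) by (simp add: convex_cone_hull cone_cone_hull)
  then have add: "x + y \<in> cone hull P" if "x \<in> cone hull P" "y \<in> cone hull P" for x y
    using that unfolding convex_cone by blast
  have zero: "0 \<in> cone hull P"
    using assms(2) cone_hull_contains_0 by blast
  have "(\<Sum>u\<in>S. c u *\<^sub>R u) \<in> cone hull P" if "finite S" "S \<subseteq> P" "\<forall>u\<in>S. 0 \<le> c u"
    for S and c :: "'a \<Rightarrow> real"
    using that by (induction S rule: finite_induct) (auto intro!: zero add mem_cone_hull)
  then show "conical_hull P \<subseteq> cone hull P"
    unfolding conical_hull_def by blast
  have "l *\<^sub>R x \<in> conical_hull P" if "0 \<le> l" "x \<in> P" for l x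
    unfolding conical_hull_def using that
    by (intro CollectI exI[of _ "{x}"] exI[of _ "\<lambda>_. l"]) auto
  then show "cone hull P \<subseteq> conical_hull P"
    by (auto simp: cone_hull_expl)
qed

text \<open>Coordinate projection commutes with scaling, and scaling never enlarges the support (it
  empties it for factor 0), so each projection of a multiple is a multiple of an admissible
  projection.\<close>

lemma CP_admissible_cone_hull:
  assumes "CP_admissible P"
  shows "CP_admissible (cone hull P)"
proof -
  have "coord_proj J (l *\<^sub>R x) \<in> cone hull P"
    if "0 \<le> l" "x \<in> P" "J \<subseteq> supp (l *\<^sub>R x)" for l x J
  proof -
    have "supp (l *\<^sub>R x) \<subseteq> supp x"
      by (auto simp: supp_def)
    then have "coord_proj J x \<in> P"
      using assms that unfolding CP_admissible_def by blast
    moreover have "coord_proj J (l *\<^sub>R x) = l *\<^sub>R coord_proj J x"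
      by (simp add: coord_proj_def vec_eq_iff)
    ultimately show ?thesis
      using that(1) by (simp add: mem_cone_hull)
  qed
  then have "coord_proj J y \<in> cone hull P" if "y \<in> cone hull P" "J \<subseteq> supp y" for y J
    using that by (auto simp: cone_hull_expl[of P])
  moreover have "cone hull P \<noteq> {}"
    using assms cone_hull_empty_iff unfolding CP_admissible_def by blast
  ultimately show ?thesis
    unfolding CP_admissible_def by blast
qed

lemma closed_CP_admissible_cone:
  fixes C :: "(real ^ 'n) set"
  assumes "convex C" and "cone C" and "CP_admissible C"
  shows "closed C"
proof -
  have add: "x + y \<in> C" if "x \<in> C" "y \<in> C" for x y
    using assms(1,2) that convex_cone by blast
  have scale: "c *\<^sub>R x \<in> C" if "x \<in> C" "0 \<le> c" for x c
    using assms(2) that by (simp add: cone_def)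
  have zero: "0 \<in> C"
    using assms(2,3) cone_contains_0 by (auto simp: CP_admissible_def)
  have "y \<in> C" if y: "y \<in> closure C" for y
  proof -
    \<comment> \<open>The open set of vectors with the same sign as \<open>y\<close> at each index
      of \<open>supp y\<close>; coordinates off \<open>supp y\<close> are unrestricted.\<close>
    let ?U = "\<Inter>i\<in>supp y. {z. 0 < z $ i * y $ i}"
    have "open ?U"
      by (intro open_INT ballI open_Collect_less continuous_intros) auto
    moreover have "y \<in> ?U"
      by (simp add: supp_def flip: power2_eq_square)
    ultimately obtain z where z: "z \<in> C" "z \<in> ?U"
      using y closure_iff_nhds_not_empty[of y C] by blast
    \<comment> \<open>It suffices to place each coordinate part of \<open>y\<close> in
      \<open>C\<close>, since \<open>y\<close> is their sum.\<close>
    have axis: "axis i (y $ i) \<in> C" for i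
    proof (cases "y $ i = 0")
      case True
      then show ?thesis
        using zero by (simp add: axis_def vec_eq_iff zero_vec_def)
    next
      case False
      then have pos: "0 < z $ i * y $ i"
        using z(2) by (auto simp: supp_def)
      then have "{i} \<subseteq> supp z"
        by (auto simp: supp_def)
      then have "coord_proj {i} z \<in> C"
        using assms(3) z(1) unfolding CP_admissible_def by blast
      \<comment> \<open>Agreement of signs makes this factor nonnegative; it rescales the
        \<open>i\<close>-th part of \<open>z\<close> exactly to that of \<open>y\<close>.\<close>
      moreover have "0 \<le> y $ i / z $ i"
        using pos by (auto simp: zero_less_mult_iff zero_le_divide_iff)
      ultimately have "(y $ i / z $ i) *\<^sub>R coord_proj {i} z \<in> C"
        by (rule scale)
      moreover have "(y $ i / z $ i) *\<^sub>R coord_proj {i} z = axis i (y $ i)"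
        using pos by (auto simp: coord_proj_def axis_def vec_eq_iff)
      ultimately show ?thesis
        by simp
    qed
    have "(\<Sum>i\<in>I. axis i (y $ i)) \<in> C" if "finite I" for I
      using that by (induction I rule: finite_induct) (auto intro: zero add axis)
    moreover have "y = (\<Sum>i\<in>UNIV. axis i (y $ i))"
      by (simp add: vec_eq_iff axis_def)
    ultimately show ?thesis
      by (metis finite)
  qed
  then show ?thesis
    using closure_subset_eq by blast
qed

theorem proposition4p4:
  fixes P :: "(real ^ 'n) set"
  assumes "closed P" and "convex P" and "CP_admissible P"
  shows "conical_hull P = {l *\<^sub>R x | l x. 0 \<le> l \<and> x \<in> P} \<and>
         closed (conical_hull P) \<and> convex (conical_hull P) \<and>
         CP_admissible (conical_hull P) \<and> cone (conical_hull P)"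
proof -
  have "P \<noteq> {}"
    using assms(3) by (simp add: CP_admissible_def)
  with assms(2) have "conical_hull P = cone hull P"
    by (rule conical_hull_convex)
  moreover have "convex (cone hull P)" "cone (cone hull P)" "CP_admissible (cone hull P)"
    using assms by (simp_all add: convex_cone_hull cone_cone_hull CP_admissible_cone_hull)
  \<comment> \<open>The ray description is \<open>cone_hull_expl\<close>; closedness comes from the
    other three properties of the hull.\<close>
  ultimately show ?thesis
    by (simp add: closed_CP_admissible_cone cone_hull_expl)
qed

end
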